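(* Let $S:X\to X$ satisfy the standing hypotheses (i)–(vi) listed in the context, and let $K$ be the support of an invariant measure $\mu$ for $S$. Then every point of $K$ is chain recurrent for $S|K$. If $\mu$ is ergodic, then $K$ is attractor-free.
   Context: $E$ is an ordered (real) Banach space whose (closed, convex, pointed) order cone $E^+=\{x\in E: x\ge 0\}$ has nonempty interior $\mathrm{Int}\,E^+$. Write $x\ge y$ if $x-y\in E^+$, $x>y$ if $x\ge y$ and $x\ne y$, $x\gg y$ if $x-y\in \mathrm{Int}\,E^+$; $[p,q]=\{x\in E:p\le x\le q\}$. Standing hypotheses on $S$ (the orbit closure of $x$ is the closure of $\{S^nx:n=0,1,2,\dots\}$): (i) $X\subset E$ is open and order convex: if $p,q\in X$ then $[p,q]\subset X$. (ii) $S:X\to X$ is $C^1$ (continuously Fréchet differentiable). (iii) $S$ is order compact: for $p,q\in X$, the image $S([p,q])$ has compact closure in $X$. (iv) For each $x\in X$ the derivative $DS(x):E\to E$ is strongly positive: $DS(x)u\gg0$ if $u>0$. (This implies $S$ is strongly monotone: $Sx\gg Sy$ if $x>y$.) (v) $S$ is completely continuous: the image of any bounded set has compact closure in $X$; moreover each derivative $DS(x)$ is completely continuous (compact). (vi) Every orbit closure is a compact subset of $X$. An invariant measure $\mu$ for $S$ is a Borel probability measure on $X$ with compact support such that $\mu(U)=\mu(S^{-1}U)$ for every $\mu$-measurable set $U$. The support of $\mu$ is the complement in $X$ of the union of all open sets $U$ with $\mu(U)=0$; it is an invariant set ($S(K)=K$). $\mu$ is ergodic if every measurable invariant set (a set $A$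 with $S(A)=A$) has measure zero or one. For a continuous map $T:Y\to Y$ of a metric space with metric $d$ (here $Y=K$ with the metric induced by the norm), $u\in Y$ is chain recurrent for $T$ if for every $\epsilon>0$ there exist $k\ge1$ and points $u=y_0,y_1,\dots,y_k=u$ in $Y$ with $d(Ty_{i-1},y_i)<\epsilon$ for $i=1,\dots,k$. For a continuous map $T:Y\to Y$, a nonempty compact set $A\subset Y$ is an attractor if $T(A)=A$ and $A$ is contained in an open set $W\subset Y$ such that $\lim_{n\to\infty}\mathrm{dist}(T^nw,A)=0$ uniformly in $w\in W$. It is a proper attractor if also $A\ne Y$. A nonempty compact invariant set $Y\subset X$ is attractor-free if $S|Y:Y\to Y$ has no proper attractor. *)

theory Defs
  imports "HOL-Analysis.Analysis"
begin

(* An ordered Banach space is a type of sort {banach, ordered_real_vector}. The class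
   ordered_real_vector says that order_cone below is a convex cone inducing the order, and
   antisymmetry of the order says that it is pointed; closedness of the cone and nonemptiness
   of its interior are not part of the sort and have to be assumed separately. *)

definition order_cone :: "'a::ordered_real_vector set" where
  "order_cone = {x. 0 \<le> x}"

definition strongly_greater :: "'a::{banach, ordered_real_vector} \<Rightarrow> 'a \<Rightarrow> bool"
    (infix "\<ggreater>" 50) where
  "x \<ggreater> y \<longleftrightarrow> x - y \<in> interior order_cone"

(* The relative closure X \<inter> closure A is compact iff closure A is compact and contained in X. *)
definition compact_closure_in :: "'a::metric_space set \<Rightarrow> 'a set \<Rightarrow> bool" where
  "compact_closure_in X A \<longleftrightarrow> compact (closure A) \<and> closure A \<subseteq> X"

definition measure_support :: "'a::topological_space measure \<Rightarrow> 'a set" where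
  "measure_support M =
     space M - \<Union>{U. openin (top_of_set (space M)) U \<and> emeasure M U = 0}"

definition invariant_measure ::
    "'a::metric_space set \<Rightarrow> ('a \<Rightarrow> 'a) \<Rightarrow> 'a measure \<Rightarrow> bool" where
  "invariant_measure X S M \<longleftrightarrow>
     space M = X \<and> sets M = sets (restrict_space borel X) \<and> emeasure M X = 1 \<and>
     compact (measure_support M) \<and>
     (\<forall>U\<in>sets M. emeasure M U = emeasure M (S -` U \<inter> X))"

definition ergodic_measure :: "('a \<Rightarrow> 'a) \<Rightarrow> 'a measure \<Rightarrow> bool" where
  "ergodic_measure S M \<longleftrightarrow>
     (\<forall>A\<in>sets M. S ` A = A \<longrightarrow> emeasure M A = 0 \<or> emeasure M A = 1)"

definition chain_recurrent ::
    "('a::metric_space \<Rightarrow> 'a) \<Rightarrow> 'a set \<Rightarrow> 'a \<Rightarrow> bool" where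
  "chain_recurrent T Y u \<longleftrightarrow> u \<in> Y \<and>
     (\<forall>\<epsilon>>0. \<exists>k\<ge>1. \<exists>y::nat \<Rightarrow> 'a.
        y 0 = u \<and> y k = u \<and> (\<forall>i\<le>k. y i \<in> Y) \<and>
        (\<forall>i\<in>{1..k}. dist (T (y (i - 1))) (y i) < \<epsilon>))"

(* W ranges over the relatively open subsets of Y, as T is regarded as a self-map of Y. *)
definition attractor ::
    "('a::metric_space \<Rightarrow> 'a) \<Rightarrow> 'a set \<Rightarrow> 'a set \<Rightarrow> bool" where
  "attractor T Y A \<longleftrightarrow>
     A \<noteq> {} \<and> compact A \<and> A \<subseteq> Y \<and> T ` A = A \<and>
     (\<exists>W. openin (top_of_set Y) W \<and> A \<subseteq> W \<and>
        uniform_limit W (\<lambda>n w. infdist ((T ^^ n) w) A) (\<lambda>_. 0) sequentially)"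

definition proper_attractor ::
    "('a::metric_space \<Rightarrow> 'a) \<Rightarrow> 'a set \<Rightarrow> 'a set \<Rightarrow> bool" where
  "proper_attractor T Y A \<longleftrightarrow> attractor T Y A \<and> A \<noteq> Y"

definition attractor_free ::
    "('a::metric_space \<Rightarrow> 'a) \<Rightarrow> 'a set \<Rightarrow> bool" where
  "attractor_free T Y \<longleftrightarrow>
     Y \<noteq> {} \<and> compact Y \<and> T ` Y = Y \<and> \<not> (\<exists>A. proper_attractor T Y A)"

end

theory Submission
  imports Defs "HOL-Probability.Probability_Measure"
begin

text \<open>
  The proof is recurrence for a continuous map that preserves a probability measure, once \<open>\<mu>\<close> is
  known to live on its support. For the latter, complete continuity places \<open>S ` X\<close> in a countable
  union of compact subsets of \<open>X\<close>.

  The space may be nonseparable, so it is not automatic that the support \<open>K\<close> has full measure: the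
  union of all null open sets might fail to be null. But invariance concentrates \<open>\<mu>\<close> on any
  measurable set that contains \<open>S ` X\<close>, hence on a \<open>\<sigma>\<close>-compact set, and there countably
  many null open sets suffice to cover the complement of \<open>K\<close>. This gives \<open>\<mu> K = 1\<close>
  (lemma \<open>emeasure_support_eq_1\<close>). Consequently every nonempty relatively open subset of \<open>K\<close> has
  positive measure, while a closed set of full measure contains \<open>K\<close>; the latter gives \<open>S ` K = K\<close>.

  \<^emph>\<open>Chain recurrence.\<close> Every neighbourhood of \<open>u \<in> K\<close> in \<open>K\<close> has positive measure, so by
  Poincare recurrence it contains a point \<open>x\<close> with a later iterate in it as well. Replacing both
  ends of this orbit segment by \<open>u\<close> gives a chain from \<open>u\<close> to itself
  (lemma \<open>support_chain_recurrent\<close>).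

  \<^emph>\<open>Attractors.\<close> Let \<open>A\<close> be an attractor for \<open>S\<close> on \<open>K\<close>, with uniformly attracted neighbourhood
  \<open>W\<close>. Late images of \<open>W\<close> lie in arbitrarily small neighbourhoods of \<open>A\<close>, so
  \<open>\<mu> W \<le> \<mu> A\<close> by invariance, and \<open>A\<close> cannot be null. If \<open>\<mu>\<close> is ergodic, then
  \<open>\<mu> A = 1\<close>, and \<open>A = K\<close> (lemma \<open>ergodic_support_attractor_free\<close>).
\<close>

section \<open>Continuous maps with an invariant Borel probability measure\<close>

locale invariant_borel_measure =
  fixes X :: "'a::metric_space set" and S :: "'a \<Rightarrow> 'a" and M :: "'a measure"
  assumes X_open: "open X"
    and S_maps: "S ` X \<subseteq> X"
    and S_cont: "continuous_on X S"
    and inv: "invariant_measure X S M"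
begin

abbreviation K :: "'a set" where "K \<equiv> measure_support M"

lemma space_eq: "space M = X"
  and sets_eq: "sets M = sets (restrict_space borel X)"
  and emeasure_X: "emeasure M X = 1"
  and compact_K: "compact K"
  and emeasure_vimage_S: "U \<in> sets M \<Longrightarrow> emeasure M (S -` U \<inter> X) = emeasure M U"
  using inv unfolding invariant_measure_def by auto

sublocale prob_space M
  by (rule prob_spaceI) (simp add: space_eq emeasure_X)

lemma sets_iff: "A \<in> sets M \<longleftrightarrow> A \<in> sets borel \<and> A \<subseteq> X"
  using X_open by (auto simp: sets_eq sets_restrict_space_iff borel_open)

lemma K_subset: "K \<subseteq> X"
  by (auto simp: measure_support_def space_eq)

lemma sets_compact: "compact C \<Longrightarrow> C \<subseteq> X \<Longrightarrow> C \<in> sets M"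
  by (simp add: sets_iff borel_compact)

lemma sets_open: "open U \<Longrightarrow> U \<subseteq> X \<Longrightarrow> U \<in> sets M"
  by (simp add: sets_iff borel_open)

lemma sets_K: "K \<in> sets M"
  using compact_K K_subset by (rule sets_compact)

lemma null_open_disjoint_support:
  assumes "open U" "U \<subseteq> X" "emeasure M U = 0"
  shows "U \<inter> K = {}"
  using assms X_open by (auto simp: measure_support_def space_eq openin_open_eq)

lemma not_in_supportE:
  assumes "x \<in> X" "x \<notin> K"
  obtains U where "open U" "U \<subseteq> X" "x \<in> U" "emeasure M U = 0"
  using assms X_open by (auto simp: measure_support_def space_eq openin_open_eq)

lemma S_measurable: "S \<in> measurable M M"
proof -
  have "S \<in> measurable (restrict_space borel X) (restrict_space borel X)"
    using S_maps S_cont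
    by (intro measurable_restrict_space2 borel_measurable_continuous_on_restrict)
       (auto simp: space_restrict_space)
  then show ?thesis
    using measurable_cong_sets[OF sets_eq sets_eq] by simp
qed

lemma funpow_in_X: "x \<in> X \<Longrightarrow> (S ^^ n) x \<in> X"
  using S_maps by (induction n) auto

lemma emeasure_vimage_funpow:
  assumes U: "U \<in> sets M"
  shows "(S ^^ n) -` U \<inter> X \<in> sets M \<and> emeasure M ((S ^^ n) -` U \<inter> X) = emeasure M U"
proof (induction n)
  case 0
  have "U \<inter> X = U" using U by (auto simp: sets_iff)
  then show ?case using U by simp
next
  case (Suc n)
  let ?V = "(S ^^ n) -` U \<inter> X"
  have eq: "(S ^^ Suc n) -` U \<inter> X = S -` ?V \<inter> X"
    using S_maps by (auto simp: funpow_swap1)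
  show ?case
    using Suc emeasure_vimage_S[of ?V] measurable_sets[OF S_measurable, of ?V]
    unfolding eq by (simp add: space_eq)
qed

text \<open>
  Poincare recurrence, in the weak form that one return of one point suffices: the preimages of a
  set under the iterates all have the same measure, so in a probability space they cannot be
  pairwise disjoint unless the set is null.
\<close>
lemma recurrence:
  assumes U: "U \<in> sets M" and pos: "emeasure M U \<noteq> 0"
  obtains x n where "x \<in> U" "n \<ge> 1" "(S ^^ n) x \<in> U"
proof -
  define V where "V n = (S ^^ n) -` U \<inter> X" for n
  have V: "V n \<in> sets M" "measure M (V n) = measure M U" for n
    using emeasure_vimage_funpow[OF U, of n] by (auto simp: V_def measure_def)
  have "\<not> disjoint_family V"
  proof
    assume "disjoint_family V"
    then have "(\<lambda>n. measure M (V n)) sums measure M (\<Union>n. V n)"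
      using V(1) by (intro finite_measure_UNION) auto
    then have "summable (\<lambda>n::nat. measure M U)"
      by (simp add: V(2) sums_iff)
    then have "measure M U = 0"
      by (simp add: summable_const_iff)
    then show False
      using pos by (simp add: emeasure_eq_measure)
  qed
  then obtain m n where mn: "m < n" "V m \<inter> V n \<noteq> {}"
    unfolding disjoint_family_on_def by (metis Int_commute linorder_neqE_nat)
  then obtain y where y: "(S ^^ m) y \<in> U" "(S ^^ n) y \<in> U"
    by (auto simp: V_def)
  have "(S ^^ (n - m)) ((S ^^ m) y) = (S ^^ n) y"
    using mn(1) by (metis funpow_add comp_apply le_add_diff_inverse2 less_imp_le)
  with y mn(1) that[of "(S ^^ m) y" "n - m"] show thesis
    by simp
qed

text \<open>
  Finitely many null open sets cover a compact set that misses the support.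
\<close>
lemma compact_disjoint_support_null:
  assumes C: "compact C" "C \<subseteq> X" "C \<inter> K = {}"
  shows "emeasure M C = 0"
proof -
  let ?N = "{U. open U \<and> U \<subseteq> X \<and> emeasure M U = 0}"
  have "C \<subseteq> \<Union>?N"
  proof
    fix x assume "x \<in> C"
    then have "x \<in> X" "x \<notin> K" using C by auto
    then obtain U where "open U" "U \<subseteq> X" "x \<in> U" "emeasure M U = 0"
      by (rule not_in_supportE)
    then show "x \<in> \<Union>?N" by blast
  qed
  then obtain F where F: "F \<subseteq> ?N" "finite F" "C \<subseteq> \<Union>F"
    using compactE[OF C(1), of ?N] by blast
  have "\<Union>F \<in> null_sets M"
  proof -
    have "(\<Union>U\<in>F. U) \<in> null_sets M"
      using F by (intro null_sets_UN' countable_finite) (auto intro: sets_open)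
    then show ?thesis by simp
  qed
  then have "C \<in> null_sets M"
    using sets_compact[OF C(1,2)] F(3) by (rule null_sets_subset)
  then show ?thesis by auto
qed

text \<open>
  The union \<open>Q\<close> of the compact sets \<open>C n\<close> has preimage \<open>X\<close>, hence full measure. The open set
  \<open>X - K\<close> is a countable union of closed sets, which cut each \<open>C n\<close> in compact sets that miss the
  support.
\<close>
lemma emeasure_support_eq_1:
  fixes C :: "nat \<Rightarrow> 'a set"
  assumes C: "\<And>n. compact (C n)" "\<And>n. C n \<subseteq> X" and SX: "S ` X \<subseteq> (\<Union>n. C n)"
  shows "emeasure M K = 1"
proof -
  define Q where "Q = (\<Union>n. C n)"
  have Qs: "Q \<in> sets M"
    unfolding Q_def using sets_compact[OF C] by blast
  have "S -` Q \<inter> X = X"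
    using SX unfolding Q_def by blast
  then have "emeasure M Q = 1"
    using emeasure_vimage_S[OF Qs] emeasure_X by simp
  then have nullQ: "X - Q \<in> null_sets M"
    using Qs by (simp add: prob_compl emeasure_eq_measure null_sets_def space_eq[symmetric])
  have "open (X - K)"
    using X_open compact_imp_closed[OF compact_K] by (rule open_Diff)
  then obtain F :: "nat \<Rightarrow> 'a set" where F: "\<And>j. closed (F j)" "X - K = (\<Union>j. F j)"
    using open_imp_fsigma_in[OF metrizable_space_euclidean, of "X - K"]
    unfolding fsigma_in_ascending by (metis closed_closedin open_openin)
  have null: "C n \<inter> F j \<in> null_sets M" for n j
  proof -
    have "compact (C n \<inter> F j)" "C n \<inter> F j \<subseteq> X" "C n \<inter> F j \<inter> K = {}"
      using C(1)[of n] F(1)[of j] F(2) C(2)[of n] by (auto intro: compact_Int_closed)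
    then show ?thesis
      using compact_disjoint_support_null sets_compact by (auto simp: null_sets_def)
  qed
  have "(X - Q) \<union> (\<Union>n. \<Union>j. C n \<inter> F j) \<in> null_sets M"
    using nullQ null by (intro null_sets.Un null_sets_UN)
  moreover have "X - K \<subseteq> (X - Q) \<union> (\<Union>n. \<Union>j. C n \<inter> F j)"
    using F(2) by (auto simp: Q_def)
  moreover have "X - K \<in> sets M"
    using sets_K space_eq by (metis sets.compl_sets)
  ultimately have "X - K \<in> null_sets M"
    by (metis null_sets_subset)
  then have "measure M (X - K) = 0"
    by (auto simp: measure_def)
  then show ?thesis
    using prob_compl[OF sets_K] by (simp add: space_eq emeasure_eq_measure)
qed

end

section \<open>Supports of full measure\<close>

locale invariant_borel_measure_full = invariant_borel_measure +
  assumes full: "emeasure M K = 1"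
begin

lemma support_nonempty: "K \<noteq> {}"
  using full by auto

lemma support_subset_of_full_measure:
  assumes "closed A" "A \<subseteq> X" "emeasure M A = 1"
  shows "K \<subseteq> A"
proof -
  have A: "A \<in> sets M"
    using assms by (simp add: sets_iff borel_closed)
  have "emeasure M (X - A) = 0"
    using prob_compl[OF A] assms(3) by (simp add: emeasure_eq_measure space_eq)
  then have "(X - A) \<inter> K = {}"
    using X_open assms(1) by (intro null_open_disjoint_support open_Diff) auto
  then show ?thesis using K_subset by auto
qed

lemma relatively_open_support_not_null:
  assumes W: "openin (top_of_set K) W" "W \<noteq> {}"
  shows "W \<in> sets M" "emeasure M W \<noteq> 0"
proof -
  obtain V where V: "open V" "W = K \<inter> V"
    using W(1) by (auto simp: openin_open)
  have VX: "open (V \<inter> X)" "V \<inter> X \<in> sets M"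
    using V(1) X_open by (auto intro: sets_open)
  have W_eq: "W = (V \<inter> X) \<inter> K"
    using V(2) K_subset by auto
  then show Ws: "W \<in> sets M"
    using VX(2) sets_K by simp
  show "emeasure M W \<noteq> 0"
  proof
    assume "emeasure M W = 0"
    then have "W \<in> null_sets M" using Ws by auto
    moreover have "X - K \<in> null_sets M"
      using prob_compl[OF sets_K] full sets.compl_sets[OF sets_K]
      by (simp add: emeasure_eq_measure space_eq null_sets_def)
    ultimately have "W \<union> (X - K) \<in> null_sets M" by auto
    then have "V \<inter> X \<in> null_sets M"
      using VX(2) by (rule null_sets_subset) (auto simp: W_eq)
    then have "(V \<inter> X) \<inter> K = {}"
      using VX(1) by (intro null_open_disjoint_support) auto
    then show False using W(2) W_eq by simp
  qed
qed

text \<open>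
  A point of \<open>K\<close> cannot be mapped into a null open set, as the preimage would be a null open
  neighbourhood of it; and \<open>S ` K\<close> is a closed set of full measure.
\<close>
lemma image_support: "S ` K = K"
proof
  show sub: "S ` K \<subseteq> K"
  proof (rule image_subsetI, rule ccontr)
    fix x assume x: "x \<in> K" "S x \<notin> K"
    then have "S x \<in> X" using K_subset S_maps by auto
    then obtain U where U: "open U" "U \<subseteq> X" "S x \<in> U" "emeasure M U = 0"
      using x(2) by (rule not_in_supportE)
    have "open (S -` U \<inter> X)"
      using continuous_open_preimage[OF S_cont X_open U(1)] by (simp add: Int_commute)
    moreover have "emeasure M (S -` U \<inter> X) = 0"
      using emeasure_vimage_S[OF sets_open[OF U(1,2)]] U(4) by simp
    ultimately have "(S -` U \<inter> X) \<inter> K = {}"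
      by (intro null_open_disjoint_support) auto
    then show False using x U(3) K_subset by auto
  qed
  have comp: "compact (S ` K)"
    using compact_K S_cont K_subset
    by (metis compact_continuous_image continuous_on_subset)
  have SKX: "S ` K \<subseteq> X" using sub K_subset by auto
  have "emeasure M K \<le> emeasure M (S -` (S ` K) \<inter> X)"
    using K_subset measurable_sets[OF S_measurable sets_compact[OF comp SKX]]
    by (intro emeasure_mono) (auto simp: space_eq)
  then have "1 \<le> emeasure M (S ` K)"
    using emeasure_vimage_S[OF sets_compact[OF comp SKX]] full by simp
  then have "emeasure M (S ` K) = 1"
    using emeasure_le_1 by (metis order_antisym)
  then show "K \<subseteq> S ` K"
    using compact_imp_closed[OF comp] SKX by (intro support_subset_of_full_measure)
qed

lemma funpow_in_support: "x \<in> K \<Longrightarrow> (S ^^ n) x \<in> K"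
  using image_support by (induction n) auto

text \<open>
  The chain follows a nearly returning orbit segment \<open>x, S x, \<dots>, (S ^^ n) x\<close>, with both ends
  replaced by the nearby point \<open>u\<close>. For \<open>n = 1\<close> both replacements happen in the same step, so each
  of them may cost only \<open>\<epsilon> / 2\<close>.
\<close>
lemma support_chain_recurrent:
  assumes u: "u \<in> K"
  shows "chain_recurrent S K u"
  unfolding chain_recurrent_def
proof (intro conjI allI impI u)
  fix e :: real assume e: "e > 0"
  obtain d0 where d0: "d0 > 0" "\<And>x. x \<in> X \<Longrightarrow> dist x u < d0 \<Longrightarrow> dist (S x) (S u) < e / 2"
    using S_cont u K_subset e unfolding continuous_on_iff
    by (metis half_gt_zero subsetD)
  define d where "d = min d0 (e / 2)"
  have d: "d > 0" using d0 e by (simp add: d_def)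
  define W where "W = K \<inter> ball u d"
  have W: "openin (top_of_set K) W" "W \<noteq> {}"
    using u d by (auto simp: W_def openin_open)
  obtain x n where x: "x \<in> W" "n \<ge> 1" "(S ^^ n) x \<in> W"
    using recurrence[OF relatively_open_support_not_null[OF W]] .
  define y where "y i = (if i = 0 \<or> i = n then u else (S ^^ i) x)" for i
  have xK: "x \<in> K" using x(1) by (simp add: W_def)
  have start: "dist (S u) (S x) < e / 2"
    using d0(2)[of x] x(1) K_subset by (auto simp: W_def d_def dist_commute)
  have stop: "dist ((S ^^ n) x) u < e / 2"
    using x(3) by (auto simp: W_def d_def dist_commute)
  have step: "dist (S (y (i - 1))) (y i) < e" if i: "i \<in> {1..n}" for i
  proof -
    have iter: "S ((S ^^ (i - 1)) x) = (S ^^ i) x"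
      using i by (metis funpow.simps(2) comp_apply Suc_pred' atLeastAtMost_iff
          less_eq_Suc_le One_nat_def)
    have "dist (S (y (i - 1))) ((S ^^ i) x) < e / 2"
      using i start iter e by (cases "i = 1") (auto simp: y_def)
    moreover have "dist ((S ^^ i) x) (y i) < e / 2"
      using i stop e by (auto simp: y_def)
    ultimately show ?thesis
      using dist_triangle[of "S (y (i - 1))" "y i" "(S ^^ i) x"] by simp
  qed
  have "y i \<in> K" for i
    using funpow_in_support[OF xK] u by (simp add: y_def)
  moreover have "y 0 = u" "y n = u"
    by (simp_all add: y_def)
  ultimately have "n \<ge> 1 \<and> y 0 = u \<and> y n = u \<and> (\<forall>i\<le>n. y i \<in> K) \<and>
      (\<forall>i\<in>{1..n}. dist (S (y (i - 1))) (y i) < e)"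
    using x(2) step by simp
  then show "\<exists>k\<ge>1. \<exists>y::nat \<Rightarrow> 'a. y 0 = u \<and> y k = u \<and> (\<forall>i\<le>k. y i \<in> K) \<and>
      (\<forall>i\<in>{1..k}. dist (S (y (i - 1))) (y i) < e)"
    by blast
qed

text \<open>
  For every \<open>\<epsilon> > 0\<close> some iterate maps the attracted neighbourhood \<open>W\<close> into the closed
  \<open>\<epsilon>\<close>-neighbourhood of \<open>A\<close>, so that neighbourhood has measure at least \<open>\<mu> W > 0\<close>; these
  neighbourhoods decrease to \<open>A\<close>.
\<close>
lemma attractor_not_null:
  assumes A: "attractor S K A"
  shows "emeasure M A \<noteq> 0"
proof
  assume null: "emeasure M A = 0"
  obtain W where A': "A \<noteq> {}" "compact A" "A \<subseteq> K"
    and W: "openin (top_of_set K) W" "A \<subseteq> W"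
    and lim: "uniform_limit W (\<lambda>n w. infdist ((S ^^ n) w) A) (\<lambda>_. 0) sequentially"
    using A unfolding attractor_def by blast
  have "W \<noteq> {}" using A'(1) W(2) by auto
  note Wpos = relatively_open_support_not_null[OF W(1) this]
  define N where "N j = {x \<in> X. infdist x A \<le> 1 / real (Suc j)}" for j
  have Ns: "N j \<in> sets M" for j
  proof -
    have "closed {x. infdist x A \<le> 1 / real (Suc j)}"
      by (intro closed_Collect_le continuous_intros)
    moreover have "N j = X \<inter> {x. infdist x A \<le> 1 / real (Suc j)}"
      by (auto simp: N_def)
    ultimately show ?thesis
      using X_open by (simp add: sets_iff borel_open borel_closed)
  qed
  have "decseq N"
  proof (rule decseq_SucI)
    fix j
    have "1 / real (Suc (Suc j)) \<le> 1 / real (Suc j)"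
      by (simp add: field_simps)
    then show "N (Suc j) \<subseteq> N j"
      by (auto simp: N_def)
  qed
  moreover have "(\<Inter>j. N j) = A"
  proof (intro equalityI subsetI)
    fix x assume "x \<in> (\<Inter>j. N j)"
    then have small: "infdist x A \<le> 1 / real (Suc j)" for j
      by (simp add: N_def)
    have "infdist x A \<le> 0"
      using LIMSEQ_le_const[OF LIMSEQ_Suc[OF lim_1_over_n] exI[of _ 0]] small by blast
    then have "infdist x A = 0"
      using infdist_nonneg[of x A] by simp
    then show "x \<in> A"
      using in_closed_iff_infdist_zero[OF compact_imp_closed[OF A'(2)] A'(1)] by simp
  next
    fix x assume "x \<in> A"
    then show "x \<in> (\<Inter>j. N j)"
      using A'(3) K_subset by (auto simp: N_def)
  qed
  ultimately have "(\<lambda>j. measure M (N j)) \<longlonglongrightarrow> measure M A"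
    using finite_Lim_measure_decseq[of N] Ns by auto
  moreover have "measure M W \<le> measure M (N j)" for j
  proof -
    have "1 / real (Suc j) > 0" by simp
    from uniform_limitD[OF lim this] obtain n where
      n: "\<And>w. w \<in> W \<Longrightarrow> dist (infdist ((S ^^ n) w) A) 0 < 1 / real (Suc j)"
      by (auto simp: eventually_sequentially)
    have "W \<subseteq> (S ^^ n) -` N j \<inter> X"
    proof
      fix w assume w: "w \<in> W"
      then have "w \<in> X"
        using W(1) K_subset openin_imp_subset by blast
      then show "w \<in> (S ^^ n) -` N j \<inter> X"
        using n[OF w] funpow_in_X by (auto simp: N_def)
    qed
    then show ?thesis
      using emeasure_vimage_funpow[OF Ns, of n j] emeasure_mono[of W "(S ^^ n) -` N j \<inter> X" M]
      by (simp add: emeasure_eq_measure)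
  qed
  ultimately have "measure M W \<le> measure M A"
    by (meson LIMSEQ_le_const)
  then show False
    using null Wpos by (simp add: emeasure_eq_measure measure_le_0_iff)
qed

lemma ergodic_support_attractor_free:
  assumes erg: "ergodic_measure S M"
  shows "attractor_free S K"
proof -
  have "A = K" if A: "attractor S K A" for A
  proof -
    have A': "compact A" "A \<subseteq> K" "S ` A = A"
      using A by (auto simp: attractor_def)
    then have "A \<subseteq> X" using K_subset by auto
    then have "emeasure M A = 1"
      using erg A' sets_compact attractor_not_null[OF A] unfolding ergodic_measure_def by blast
    then have "K \<subseteq> A"
      using A'(1) \<open>A \<subseteq> X\<close> by (intro support_subset_of_full_measure compact_imp_closed)
    with A'(2) show ?thesis by auto
  qed
  then show ?thesis
    using support_nonempty compact_K image_support
    by (auto simp: attractor_free_def proper_attractor_def)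
qed

end

section \<open>Completely continuous maps\<close>

theorem proposition1p8:
  fixes X :: "'a::{banach, ordered_real_vector} set"
    and S :: "'a \<Rightarrow> 'a"
    and DS :: "'a \<Rightarrow> 'a \<Rightarrow>\<^sub>L 'a"
    and \<mu> :: "'a measure"
  assumes cone_closed: "closed (order_cone :: 'a set)"
    and cone_interior: "interior (order_cone :: 'a set) \<noteq> {}"
    and X_open: "open X"
    and X_order_convex: "\<And>p q. p \<in> X \<Longrightarrow> q \<in> X \<Longrightarrow> {p..q} \<subseteq> X"
    and S_maps: "S ` X \<subseteq> X"
    and S_deriv: "\<And>x. x \<in> X \<Longrightarrow> (S has_derivative blinfun_apply (DS x)) (at x)"
    and S_C1: "continuous_on X DS"
    and S_order_compact: "\<And>p q. p \<in> X \<Longrightarrow> q \<in> X \<Longrightarrow> compact_closure_in X (S ` {p..q})"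
    and DS_strongly_positive: "\<And>x u. x \<in> X \<Longrightarrow> u > 0 \<Longrightarrow> blinfun_apply (DS x) u \<ggreater> 0"
    and S_compl_cont: "\<And>B. B \<subseteq> X \<Longrightarrow> bounded B \<Longrightarrow> compact_closure_in X (S ` B)"
    and DS_compact: "\<And>x B. x \<in> X \<Longrightarrow> bounded B \<Longrightarrow> compact (closure (blinfun_apply (DS x) ` B))"
    and orbits_compact: "\<And>x. x \<in> X \<Longrightarrow> compact_closure_in X (range (\<lambda>n. (S ^^ n) x))"
    and inv: "invariant_measure X S \<mu>"
  shows "(\<forall>u\<in>measure_support \<mu>. chain_recurrent S (measure_support \<mu>) u) \<and>
    (ergodic_measure S \<mu> \<longrightarrow> attractor_free S (measure_support \<mu>))"
proof -
  have "S differentiable (at x)" if "x \<in> X" for x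
    using S_deriv[OF that] by (rule differentiableI)
  then have "continuous_on X S"
    by (intro continuous_at_imp_continuous_on ballI differentiable_imp_continuous_within)
  then interpret invariant_borel_measure X S \<mu>
    using X_open S_maps inv by unfold_locales
  \<comment> \<open>By complete continuity, the images of the bounded pieces of \<open>X\<close> exhibit \<open>S ` X\<close> as a subset of
    a \<open>\<sigma>\<close>-compact set.\<close>
  define C where "C n = closure (S ` (X \<inter> ball 0 (real n)))" for n
  have C: "compact (C n)" "C n \<subseteq> X" for n
    using S_compl_cont[of "X \<inter> ball 0 (real n)"]
    by (auto simp: C_def compact_closure_in_def bounded_Int)
  have "S ` X \<subseteq> (\<Union>n. C n)"
  proof (rule image_subsetI)
    fix x assume x: "x \<in> X"
    obtain n where "norm x < real n"
      using reals_Archimedean2 by blast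
    then have "S x \<in> C n"
      unfolding C_def using x closure_subset by fastforce
    then show "S x \<in> (\<Union>n. C n)" by blast
  qed
  then have "emeasure \<mu> (measure_support \<mu>) = 1"
    using C by (intro emeasure_support_eq_1)
  then interpret invariant_borel_measure_full X S \<mu>
    by unfold_locales
  show ?thesis
    using support_chain_recurrent ergodic_support_attractor_free by blast
qed

end
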